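(* Let $F$ be an algebraically closed field of characteristic $p>0$, let $r\ge 1$, let $G=Z_{p^r}$ be the cyclic group of order $p^r$ with generator $\sigma$, and let $V=\bigoplus_{j=1}^k V_{n_j}$ (with $1\le n_j\le p^r$) be a $G$-module over $F$ with basis $\{e_{i,j}\mid 1\le j\le k,\ 1\le i\le n_j\}$ such that $\sigma^{-1}(e_{i,j})=e_{i,j}+e_{i+1,j}$ for $1\le i<n_j$ and $\sigma^{-1}(e_{n_j,j})=e_{n_j,j}$. Let $v=\sum_{1\le j\le k}c_je_{n_j,j}\in V^{G}\setminus\{0\}$ be a nonzero fixed point, where $c_1,\ldots,c_k\in F$. Let $J$ denote the set of all $j\in\{1,\ldots,k\}$ such that $c_j\ne 0$, and let $s$ denote the maximal integer such that $p^{s-1}<n_j$ for all $j\in J$. Then $\epsilon(G,v)=p^s$. In particular, if $V$ is a faithful $G$-module, then $\delta(G,V)=p^r$.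
   Context: A $G$-module is a finite dimensional representation of the finite group $G$ over $F$. $G$ acts on the polynomial ring $F[V]$ (the symmetric algebra of $V^*$) by $\tau(f)=f\circ\tau^{-1}$ for $\tau\in G$; $F[V]^G$ is the ring of invariants and $F[V]^G_d$ its homogeneous component of degree $d$. $V^G$ is the space of fixed points; in the setting of the claim it is the $F$-span of $e_{n_1,1},\ldots,e_{n_k,k}$. $V_n$ ($1\le n\le p^r$) denotes the indecomposable $G$-module of dimension $n$ on which $\sigma^{-1}$ acts via a single Jordan block of size $n$ with eigenvalue $1$; every $G$-module is a direct sum of such modules. For $v\in V\setminus\{0\}$ put $\epsilon(G,v)=\min\{d>0\mid \text{there is } f\in F[V]^G_d \text{ with } f(v)\ne 0\}$. The degree of reductivity $\delta(G,V)$ is defined to be $0$ if $V^G=\{0\}$, and otherwise the supremum of $\epsilon(G,v)$ over all $v\in V^G\setminus\{0\}$. Exponents such as $s-1$ may be negative, e.g. $p^{-1}=1/p$. *)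

theory Defs
  imports
    "HOL-Algebra.Group_Action"
    "HOL-Algebra.Generated_Groups"
    "HOL-Computational_Algebra.Polynomial"
    "HOL-Library.Poly_Mapping"
    "HOL-Library.Extended_Nat"
begin

text \<open>
  Polynomials with coefficients in \<open>'a\<close> and indeterminates taken from \<open>'v\<close>, as finitely supported
  functions on monomials; a monomial is the finitely supported function of its exponents.
\<close>

type_synonym ('v, 'a) mpoly = "('v \<Rightarrow>\<^sub>0 nat) \<Rightarrow>\<^sub>0 'a"

definition mpoly_const :: "'a::comm_ring_1 \<Rightarrow> ('v, 'a) mpoly" where
  "mpoly_const c = Poly_Mapping.single 0 c"

definition mpoly_var :: "'v \<Rightarrow> ('v, 'a::comm_ring_1) mpoly" where
  "mpoly_var x = Poly_Mapping.single (Poly_Mapping.single x 1) 1"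

definition mono_subst :: "('v \<Rightarrow> 'b::comm_ring_1) \<Rightarrow> ('v \<Rightarrow>\<^sub>0 nat) \<Rightarrow> 'b" where
  "mono_subst \<phi> m = (\<Prod>x\<in>Poly_Mapping.keys m. \<phi> x ^ Poly_Mapping.lookup m x)"

definition mpoly_subst ::
    "('a::comm_ring_1 \<Rightarrow> 'b::comm_ring_1) \<Rightarrow> ('v \<Rightarrow> 'b) \<Rightarrow> ('v, 'a) mpoly \<Rightarrow> 'b" where
  "mpoly_subst h \<phi> f =
     (\<Sum>m\<in>Poly_Mapping.keys f. h (Poly_Mapping.lookup f m) * mono_subst \<phi> m)"

definition mpoly_homogeneous :: "nat \<Rightarrow> ('v, 'a::comm_ring_1) mpoly \<Rightarrow> bool" where
  "mpoly_homogeneous d f \<longleftrightarrow>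
     (\<forall>m\<in>Poly_Mapping.keys f. (\<Sum>x\<in>Poly_Mapping.keys m. Poly_Mapping.lookup m x) = d)"

text \<open>
  A finite dimensional representation \<open>\<rho>\<close> of a finite group \<open>G\<close>. The vector space is the whole type
  \<open>'v\<close>, with a chosen basis \<open>Basis\<close> (a parameter of the library locale).
\<close>

locale g_module =
  group_action G "UNIV :: 'v set" \<rho> + finite_dimensional_vector_space scale Basis
  for G :: "('g, 'm) monoid_scheme" (structure)
    and scale :: "'a::field \<Rightarrow> 'v::ab_group_add \<Rightarrow> 'v"
    and Basis :: "'v set"
    and \<rho> :: "'g \<Rightarrow> 'v \<Rightarrow> 'v" +
  assumes finite_carrier: "finite (carrier G)"
    and linear_act: "g \<in> carrier G \<Longrightarrow> Vector_Spaces.linear scale scale (\<rho> g)"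
begin

definition fixed_points :: "'v set" where
  "fixed_points = {v. \<forall>g\<in>carrier G. \<rho> g v = v}"

text \<open>
  The symmetric algebra of the dual space is the polynomial ring in the dual basis: the indeterminate
  \<open>b \<in> Basis\<close> stands for the coordinate function \<open>\<lambda>v. representation Basis v b\<close>.
\<close>

definition poly_ring :: "('v, 'a) mpoly set" where
  "poly_ring = {f. \<forall>m\<in>Poly_Mapping.keys f. Poly_Mapping.keys m \<subseteq> Basis}"

definition poly_eval :: "('v, 'a) mpoly \<Rightarrow> 'v \<Rightarrow> 'a" where
  "poly_eval f v = mpoly_subst (\<lambda>c. c) (\<lambda>b. representation Basis v b) f"

text \<open>
  The action \<open>f \<mapsto> f \<circ> \<rho> (inv g)\<close>: the coordinate function of \<open>b\<close> is sent to the linear form whose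
  value at a basis vector \<open>b'\<close> is the \<open>b\<close>-coordinate of \<open>\<rho> (inv g) b'\<close>.
\<close>

definition poly_act :: "'g \<Rightarrow> ('v, 'a) mpoly \<Rightarrow> ('v, 'a) mpoly" where
  "poly_act g f = mpoly_subst mpoly_const
     (\<lambda>b. \<Sum>b'\<in>Basis. mpoly_const (representation Basis (\<rho> (inv g) b') b) * mpoly_var b') f"

definition poly_invariants :: "('v, 'a) mpoly set" where
  "poly_invariants = {f \<in> poly_ring. \<forall>g\<in>carrier G. poly_act g f = f}"

definition poly_invariants_deg :: "nat \<Rightarrow> ('v, 'a) mpoly set" where
  "poly_invariants_deg d = {f \<in> poly_invariants. mpoly_homogeneous d f}"

text \<open>
  Values are taken in \<^typ>\<open>enat\<close>, where the infimum of a nonempty set is its minimum and an empty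
  set would give \<open>\<infinity>\<close>, so that neither quantity can be an arbitrary default value.
\<close>

definition epsilon :: "'v \<Rightarrow> enat" where
  "epsilon v = Inf {enat d | d. d > 0 \<and> (\<exists>f\<in>poly_invariants_deg d. poly_eval f v \<noteq> 0)}"

definition delta :: enat where
  "delta = (if fixed_points = {0} then 0 else (SUP v\<in>fixed_points - {0}. epsilon v))"

end

subsection \<open>The action on polynomials is composition with the inverse\<close>

lemma mono_subst_superset:
  assumes "finite K" "Poly_Mapping.keys m \<subseteq> K"
  shows "mono_subst \<phi> m = (\<Prod>x\<in>K. \<phi> x ^ Poly_Mapping.lookup m x)"
  unfolding mono_subst_def using assms
  by (intro prod.mono_neutral_left) (auto simp: in_keys_iff)

lemma mono_subst_zero [simp]: "mono_subst \<phi> 0 = 1"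
  by (simp add: mono_subst_def)

lemma mono_subst_add: "mono_subst \<phi> (m + m') = mono_subst \<phi> m * mono_subst \<phi> m'"
proof -
  let ?K = "Poly_Mapping.keys m \<union> Poly_Mapping.keys m'"
  have "Poly_Mapping.keys (m + m') \<subseteq> ?K" by (rule keys_add)
  then show ?thesis
    by (simp add: mono_subst_superset[of ?K] lookup_add power_add prod.distrib)
qed

lemma mpoly_subst_superset:
  assumes "finite K" "Poly_Mapping.keys f \<subseteq> K" "h 0 = 0"
  shows "mpoly_subst h \<phi> f = (\<Sum>m\<in>K. h (Poly_Mapping.lookup f m) * mono_subst \<phi> m)"
  unfolding mpoly_subst_def using assms
  by (intro sum.mono_neutral_left) (auto simp: in_keys_iff)

lemma mpoly_subst_zero [simp]: "mpoly_subst h \<phi> 0 = 0"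
  by (simp add: mpoly_subst_def)

lemma mpoly_subst_add:
  assumes "h 0 = 0" "\<And>a b. h (a + b) = h a + h b"
  shows "mpoly_subst h \<phi> (f + g) = mpoly_subst h \<phi> f + mpoly_subst h \<phi> g"
proof -
  let ?K = "Poly_Mapping.keys f \<union> Poly_Mapping.keys g"
  have "Poly_Mapping.keys (f + g) \<subseteq> ?K" by (rule keys_add)
  then show ?thesis using assms
    by (simp add: mpoly_subst_superset[of ?K] lookup_add sum.distrib distrib_right)
qed

lemma mpoly_subst_single:
  assumes "h 0 = 0"
  shows "mpoly_subst h \<phi> (Poly_Mapping.single m c) = h c * mono_subst \<phi> m"
  using assms by (simp add: mpoly_subst_def)

lemma mpoly_subst_sum:
  assumes "h 0 = 0" "\<And>a b. h (a + b) = h a + h b"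
  shows "mpoly_subst h \<phi> (sum F A) = (\<Sum>i\<in>A. mpoly_subst h \<phi> (F i))"
  using assms by (induction A rule: infinite_finite_induct) (auto simp: mpoly_subst_add)

lemma mpoly_sum_monomials: 
  "f = (\<Sum>m\<in>Poly_Mapping.keys f. Poly_Mapping.single m (Poly_Mapping.lookup f m))"
proof (rule poly_mapping_eqI)
  fix k
  show "Poly_Mapping.lookup f k =
      Poly_Mapping.lookup (\<Sum>m\<in>Poly_Mapping.keys f. Poly_Mapping.single m (Poly_Mapping.lookup f m)) k"
    by (simp add: lookup_sum lookup_single when_def in_keys_iff)
qed

lemma mpoly_subst_mult:
  assumes "h 0 = 0" "\<And>a b. h (a + b) = h a + h b" "\<And>a b. h (a * b) = h a * h b"
  shows "mpoly_subst h \<phi> (f * g) = mpoly_subst h \<phi> f * mpoly_subst h \<phi> g"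
proof -
  let ?s = "Poly_Mapping.single"
  have "f * g = (\<Sum>m\<in>Poly_Mapping.keys f. \<Sum>m'\<in>Poly_Mapping.keys g.
      ?s (m + m') (Poly_Mapping.lookup f m * Poly_Mapping.lookup g m'))"
    by (subst (1) mpoly_sum_monomials[of f], subst (1) mpoly_sum_monomials[of g])
      (simp add: sum_product mult_single)
  then have "mpoly_subst h \<phi> (f * g) = (\<Sum>m\<in>Poly_Mapping.keys f. \<Sum>m'\<in>Poly_Mapping.keys g.
      h (Poly_Mapping.lookup f m) * mono_subst \<phi> m * (h (Poly_Mapping.lookup g m') * mono_subst \<phi> m'))"
    using assms by (simp add: mpoly_subst_sum mpoly_subst_single mono_subst_add mult_ac)
  then show ?thesis
    by (simp add: mpoly_subst_def sum_product)
qed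

lemma mpoly_subst_one:
  assumes "h 0 = 0" "h 1 = 1"
  shows "mpoly_subst h \<phi> 1 = 1"
  using mpoly_subst_single[of h \<phi> 0 1] assms by simp

context g_module
begin

lemma poly_eval_add: "poly_eval (f + g) v = poly_eval f v + poly_eval g v"
  by (simp add: poly_eval_def mpoly_subst_add)

lemma poly_eval_mult: "poly_eval (f * g) v = poly_eval f v * poly_eval g v"
  by (simp add: poly_eval_def mpoly_subst_mult)

lemma poly_eval_sum: "poly_eval (sum F A) v = (\<Sum>i\<in>A. poly_eval (F i) v)"
  by (simp add: poly_eval_def mpoly_subst_sum)

lemma poly_eval_power: "poly_eval (f ^ n) v = poly_eval f v ^ n"
  by (induction n) (simp_all add: poly_eval_mult, simp add: poly_eval_def mpoly_subst_one)

lemma poly_eval_prod: "poly_eval (prod F A) v = (\<Prod>i\<in>A. poly_eval (F i) v)"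
proof (induction A rule: infinite_finite_induct)
qed (simp_all add: poly_eval_mult, simp_all add: poly_eval_def mpoly_subst_one)

lemma poly_eval_const [simp]: "poly_eval (mpoly_const c) v = c"
  by (simp add: poly_eval_def mpoly_const_def mpoly_subst_single)

lemma poly_eval_var [simp]: "poly_eval (mpoly_var b) v = representation Basis v b"
  by (simp add: poly_eval_def mpoly_var_def mpoly_subst_single mono_subst_def)

lemma representation_act:
  assumes "g \<in> carrier G"
  shows "representation Basis (\<rho> g v) b
    = (\<Sum>b'\<in>Basis. representation Basis (\<rho> g b') b * representation Basis v b')"
proof -
  interpret L: Vector_Spaces.linear scale scale "\<rho> g" using linear_act[OF assms] .
  have "v = (\<Sum>b'\<in>Basis. scale (representation Basis v b') b')"
    using sum_representation_eq[OF independent_Basis, of v Basis]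
    by (simp add: span_Basis finite_Basis)
  then have "\<rho> g v = (\<Sum>b'\<in>Basis. scale (representation Basis v b') (\<rho> g b'))"
    by (metis (no_types, lifting) L.scale L.sum sum.cong)
  then show ?thesis
    by (simp add: representation_sum[OF independent_Basis] representation_scale[OF independent_Basis]
        span_Basis mult.commute)
qed

theorem poly_eval_act:
  assumes "g \<in> carrier G"
  shows "poly_eval (poly_act g f) v = poly_eval f (\<rho> (inv g) v)"
proof -
  interpret group G using group_hom by (simp add: group_hom_def)
  have "inv g \<in> carrier G" using assms by simp
  then show ?thesis
    unfolding poly_act_def mpoly_subst_def mono_subst_def
    by (simp add: poly_eval_sum poly_eval_mult poly_eval_prod poly_eval_power
        representation_act[symmetric])
      (simp add: poly_eval_def mpoly_subst_def mono_subst_def)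
qed

end

end

(* The lower bound comes from evaluating an invariant f of degree d at a point with entries in F[X]:
   giving the vector e_{i,j} the coefficient c_j X^(n_j - i) yields a point that specialises to v at
   X = 0 and that the generator multiplies by 1 + X modulo X^m, where m is the least n_j with c_j
   nonzero. Invariance and homogeneity force X^m to divide (1 + X)^d - 1, as f(v) is nonzero. The order
   of this polynomial at 0 is the largest power of p dividing d, so that power is at least m and hence
   p^s divides d.
   For the upper bound let n_j be minimal. The orbit of the last coordinate function of the block V_{n_j}
   consists of the forms sum_u (t choose u) x_{n_j - u, j}, which depend on t modulo p^s only, and their
   product over t < p^s is an invariant of degree p^s that takes the value c_j^(p^s) at v.
   If V is faithful then some n_j exceeds p^(r - 1), for otherwise the element of order p would act
   trivially; the vector e_{n_j,j} attains the supremum. *)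
theory Submission
  imports Defs "HOL-Number_Theory.Cong" "HOL-Algebra.Multiplicative_Group"
begin

section \<open>Substitution in polynomials\<close>

definition mono_degree :: "('v \<Rightarrow>\<^sub>0 nat) \<Rightarrow> nat" where
  "mono_degree m = (\<Sum>x\<in>Poly_Mapping.keys m. Poly_Mapping.lookup m x)"

lemma mono_degree_add: "mono_degree (m + m') = mono_degree m + mono_degree m'"
proof -
  let ?K = "Poly_Mapping.keys m \<union> Poly_Mapping.keys m'"
  have *: "mono_degree a = (\<Sum>x\<in>?K. Poly_Mapping.lookup a x)" if "Poly_Mapping.keys a \<subseteq> ?K" for a
    unfolding mono_degree_def using that
    by (intro sum.mono_neutral_left) (auto simp: in_keys_iff)
  show ?thesis
    by (simp add: * keys_add lookup_add sum.distrib)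
qed

lemma mpoly_homogeneous_iff:
  "mpoly_homogeneous d f \<longleftrightarrow> (\<forall>m\<in>Poly_Mapping.keys f. mono_degree m = d)"
  by (simp add: mpoly_homogeneous_def mono_degree_def)

lemma mpoly_homogeneous_sum:
  assumes "\<And>i. i \<in> A \<Longrightarrow> mpoly_homogeneous d (f i)"
  shows "mpoly_homogeneous d (sum f A)"
  using assms keys_sum[of f A] unfolding mpoly_homogeneous_iff by blast

lemma mpoly_homogeneous_mult:
  assumes "mpoly_homogeneous d f" "mpoly_homogeneous d' g"
  shows "mpoly_homogeneous (d + d') (f * g)"
  using assms keys_mult[of f g] unfolding mpoly_homogeneous_iff
  by (force simp: mono_degree_add)

lemma mpoly_homogeneous_one: "mpoly_homogeneous 0 1"
  by (simp add: mpoly_homogeneous_def)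

lemma mpoly_homogeneous_prod:
  assumes "\<And>i. i \<in> A \<Longrightarrow> mpoly_homogeneous (d i) (f i)"
  shows "mpoly_homogeneous (sum d A) (prod f A)"
  using assms
  by (induction A rule: infinite_finite_induct)
    (simp_all add: mpoly_homogeneous_mult mpoly_homogeneous_one)

lemma mpoly_const_mult_var:
  "mpoly_const c * mpoly_var b = Poly_Mapping.single (Poly_Mapping.single b 1) c"
  by (simp add: mpoly_const_def mpoly_var_def mult_single)

lemma mpoly_homogeneous_const_mult_var: "mpoly_homogeneous 1 (mpoly_const c * mpoly_var b)"
  by (simp add: mpoly_const_mult_var mpoly_homogeneous_iff mono_degree_def)

lemma mpoly_const_0 [simp]: "mpoly_const 0 = 0"
  and mpoly_const_1 [simp]: "mpoly_const 1 = 1"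
  and mpoly_const_add: "mpoly_const (c + d) = mpoly_const c + mpoly_const d"
  and mpoly_const_mult: "mpoly_const (c * d) = mpoly_const c * mpoly_const d"
  by (simp_all add: mpoly_const_def single_add mult_single)

section \<open>Substitution as a ring homomorphism\<close>

lemma mpoly_subst_cong:
  assumes "\<And>m x. m \<in> Poly_Mapping.keys f \<Longrightarrow> x \<in> Poly_Mapping.keys m \<Longrightarrow> \<phi> x = \<psi> x"
  shows "mpoly_subst h \<phi> f = mpoly_subst h \<psi> f"
  using assms unfolding mpoly_subst_def mono_subst_def by (intro sum.cong) auto

text \<open>Every monomial of degree \<open>d\<close> picks up exactly the factor
  \<open>c ^ d\<close>. This is how homogeneity enters the lower bound, with
  \<open>c = 1 + X\<close>.\<close>

lemma mpoly_subst_scale: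
  assumes "mpoly_homogeneous d f"
  shows "mpoly_subst h (\<lambda>x. c * \<phi> x) f = c ^ d * mpoly_subst h \<phi> f"
proof -
  have "mono_subst (\<lambda>x. c * \<phi> x) m = c ^ d * mono_subst \<phi> m" if "m \<in> Poly_Mapping.keys f" for m
    using assms that
    by (simp add: mpoly_homogeneous_def mono_subst_def power_mult_distrib prod.distrib power_sum[symmetric])
  then show ?thesis
    by (simp add: mpoly_subst_def sum_distrib_left mult_ac)
qed

lemma mpoly_subst_var:
  fixes f :: "('v, 'a::comm_ring_1) mpoly"
  shows "mpoly_subst mpoly_const mpoly_var f = f"
proof -
  have power: "mpoly_var x ^ n = Poly_Mapping.single (Poly_Mapping.single x n) (1::'a)" for x :: 'v and n
    by (induction n) (simp_all add: mpoly_var_def mult_single single_add[symmetric])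
  have prod: "(\<Prod>x\<in>A. Poly_Mapping.single (a x) (1::'a)) = Poly_Mapping.single (sum a A) 1"
    for A :: "'v set" and a :: "'v \<Rightarrow> ('v \<Rightarrow>\<^sub>0 nat)"
    by (induction A rule: infinite_finite_induct) (simp_all add: mult_single)
  have mono: "(\<Sum>x\<in>Poly_Mapping.keys m. Poly_Mapping.single x (Poly_Mapping.lookup m x)) = m"
    for m :: "'v \<Rightarrow>\<^sub>0 nat"
    by (rule poly_mapping_eqI) (simp add: lookup_sum lookup_single when_def in_keys_iff)
  show ?thesis
    by (simp add: mpoly_subst_def mono_subst_def power prod mono mpoly_const_def mult_single
        mpoly_sum_monomials[symmetric])
qed

text \<open>Three instances are needed: \<open>mpoly_const\<close> for the action on polynomials,
  \<open>[:c:]\<close> for points over F[X], and the identity for coordinates of vectors.\<close>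

locale coefficient_hom =
  fixes h :: "'a::comm_ring_1 \<Rightarrow> 'b::comm_ring_1"
  assumes hom_0 [simp]: "h 0 = 0" and hom_1 [simp]: "h 1 = 1"
    and hom_add: "h (a + b) = h a + h b"
    and hom_mult: "h (a * b) = h a * h b"
begin

lemma subst_const [simp]: "mpoly_subst h \<phi> (mpoly_const c) = h c"
  by (simp add: mpoly_const_def mpoly_subst_single)

lemma subst_var [simp]: "mpoly_subst h \<phi> (mpoly_var b) = \<phi> b"
  by (simp add: mpoly_var_def mpoly_subst_single mono_subst_def)

lemma subst_mult: "mpoly_subst h \<phi> (f * g) = mpoly_subst h \<phi> f * mpoly_subst h \<phi> g"
  by (rule mpoly_subst_mult) (simp_all add: hom_add hom_mult)

lemma subst_sum: "mpoly_subst h \<phi> (sum f A) = (\<Sum>i\<in>A. mpoly_subst h \<phi> (f i))"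
  by (rule mpoly_subst_sum) (simp_all add: hom_add)

lemma subst_one [simp]: "mpoly_subst h \<phi> 1 = 1"
  by (rule mpoly_subst_one) simp_all

lemma subst_prod: "mpoly_subst h \<phi> (prod f A) = (\<Prod>i\<in>A. mpoly_subst h \<phi> (f i))"
  by (induction A rule: infinite_finite_induct) (simp_all add: subst_mult)

lemma subst_power: "mpoly_subst h \<phi> (f ^ n) = mpoly_subst h \<phi> f ^ n"
  by (induction n) (simp_all add: subst_mult)

text \<open>Acting on \<open>f\<close> and then evaluating amounts to evaluating \<open>f\<close> at
  a moved point.\<close>

lemma subst_subst:
  "mpoly_subst h \<psi> (mpoly_subst mpoly_const \<phi> f) = mpoly_subst h (\<lambda>x. mpoly_subst h \<psi> (\<phi> x)) f"
  by (simp add: mpoly_subst_def[of mpoly_const] mpoly_subst_def[of _ _ f] mono_subst_def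
      subst_sum subst_mult subst_prod subst_power)

end

interpretation const_hom: coefficient_hom mpoly_const
  by unfold_locales (simp_all add: mpoly_const_add mpoly_const_mult)

interpretation poly_const_hom: coefficient_hom "\<lambda>c. [:c:]"
  by unfold_locales simp_all

section \<open>The group action on the polynomial ring and its invariants\<close>

context g_module
begin

lemma act_one: "\<rho> \<one> v = v"
  using id_eq_one by (metis UNIV_I restrict_apply')

lemma poly_ring_sum: "(\<And>i. i \<in> A \<Longrightarrow> f i \<in> poly_ring) \<Longrightarrow> sum f A \<in> poly_ring"
  using keys_sum[of f A] unfolding poly_ring_def by blast

lemma poly_ring_one: "1 \<in> poly_ring"
  by (simp add: poly_ring_def)

lemma poly_ring_mult:
  assumes "f \<in> poly_ring" "g \<in> poly_ring"
  shows "f * g \<in> poly_ring"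
proof -
  have "Poly_Mapping.keys m \<subseteq> Basis" if m: "m \<in> Poly_Mapping.keys (f * g)" for m
  proof -
    obtain a b where "m = a + b" and ab: "a \<in> Poly_Mapping.keys f" "b \<in> Poly_Mapping.keys g"
      using subsetD[OF keys_mult m] by blast
    have "Poly_Mapping.keys a \<subseteq> Basis" "Poly_Mapping.keys b \<subseteq> Basis"
      using assms ab unfolding poly_ring_def by blast+
    then show ?thesis
      unfolding \<open>m = a + b\<close> using keys_add[of a b] by blast
  qed
  then show ?thesis unfolding poly_ring_def by blast
qed

lemma poly_ring_prod: "(\<And>i. i \<in> A \<Longrightarrow> f i \<in> poly_ring) \<Longrightarrow> prod f A \<in> poly_ring"
  by (induction A rule: infinite_finite_induct) (auto intro: poly_ring_mult poly_ring_one)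

lemma poly_ring_const_mult_var: "b \<in> Basis \<Longrightarrow> mpoly_const c * mpoly_var b \<in> poly_ring"
  by (simp add: mpoly_const_mult_var poly_ring_def)

definition dual_act :: "'g \<Rightarrow> 'v \<Rightarrow> ('v, 'a) mpoly" where
  "dual_act g b = (\<Sum>b'\<in>Basis. mpoly_const (representation Basis (\<rho> (inv g) b') b) * mpoly_var b')"

lemma poly_act_subst: "poly_act g f = mpoly_subst mpoly_const (dual_act g) f"
  unfolding poly_act_def dual_act_def ..

text \<open>A product of matrices: the inverse in \<open>dual_act\<close> reverses the order and the
  passage to the dual reverses it back, so a left action results.\<close>

lemma dual_act_mult:
  assumes "g \<in> carrier G" "h \<in> carrier G"
  shows "poly_act g (dual_act h b) = dual_act (g \<otimes> h) b"
proof -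
  interpret group G using group_hom by (simp add: group_hom_def)
  have inv: "\<rho> (inv (g \<otimes> h)) v = \<rho> (inv h) (\<rho> (inv g) v)" for v
    using assms composition_rule[of v "inv h" "inv g"] by (simp add: inv_mult_group)
  have "poly_act g (dual_act h b) =
      (\<Sum>b'\<in>Basis. mpoly_const (representation Basis (\<rho> (inv h) b') b) * dual_act g b')"
    by (simp add: poly_act_subst dual_act_def[of h] const_hom.subst_sum const_hom.subst_mult)
  also have "\<dots> = (\<Sum>b''\<in>Basis. (\<Sum>b'\<in>Basis. mpoly_const (representation Basis (\<rho> (inv h) b') b
      * representation Basis (\<rho> (inv g) b'') b')) * mpoly_var b'')"
    unfolding dual_act_def sum_distrib_left sum_distrib_right
    by (subst sum.swap) (simp add: mpoly_const_mult mult_ac)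
  also have "\<dots> = (\<Sum>b''\<in>Basis. mpoly_const (representation Basis (\<rho> (inv (g \<otimes> h)) b'') b) * mpoly_var b'')"
  proof -
    have sum: "mpoly_const (sum f A) = (\<Sum>x\<in>A. mpoly_const (f x))" for f :: "'v \<Rightarrow> 'a" and A
      by (induction A rule: infinite_finite_induct) (simp_all add: mpoly_const_add)
    show ?thesis
      using assms by (simp add: inv representation_act[of "inv h" "\<rho> (inv g) _"] sum)
  qed
  finally show ?thesis by (simp add: dual_act_def)
qed

lemma poly_act_mult:
  assumes "g \<in> carrier G" "h \<in> carrier G"
  shows "poly_act (g \<otimes> h) f = poly_act g (poly_act h f)"
  using dual_act_mult[OF assms]
  by (simp add: poly_act_subst const_hom.subst_subst)

text \<open>The hypothesis \<open>f \<in> poly_ring\<close> matters: for \<open>b\<close> outside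
  \<open>Basis\<close> the form \<open>dual_act \<one> b\<close> is zero, not the
  indeterminate.\<close>

lemma poly_act_one:
  assumes "f \<in> poly_ring"
  shows "poly_act \<one> f = f"
proof -
  interpret group G using group_hom by (simp add: group_hom_def)
  have "dual_act \<one> b = mpoly_var b" if "b \<in> Basis" for b
    using that finite_Basis
    by (simp add: dual_act_def act_one representation_basis[OF independent_Basis] if_distrib if_distribR
        sum.delta cong: if_cong)
  then have "poly_act \<one> f = mpoly_subst mpoly_const mpoly_var f"
    unfolding poly_act_subst using assms by (intro mpoly_subst_cong) (auto simp: poly_ring_def)
  then show ?thesis by (simp add: mpoly_subst_var)
qed

text \<open>Induction over \<open>generate\<close>; for an inverse, \<open>poly_act (inv g)\<close>
  is applied to both sides of \<open>poly_act g f = f\<close>.\<close>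

lemma poly_invariantsI:
  assumes "generate G S = carrier G" "S \<subseteq> carrier G" "f \<in> poly_ring"
    and S: "\<And>g. g \<in> S \<Longrightarrow> poly_act g f = f"
  shows "f \<in> poly_invariants"
proof -
  interpret group G using group_hom by (simp add: group_hom_def)
  have "poly_act g f = f" if "g \<in> generate G S" for g
    using that
  proof induction
    case one
    show ?case using assms by (simp add: poly_act_one)
  next
    case (inv g)
    then have g: "g \<in> carrier G" using assms by blast
    then have "poly_act (inv g \<otimes> g) f = poly_act (inv g) f"
      using S[OF inv] poly_act_mult[of "inv g" g f] by simp
    then show ?case using g assms by (simp add: poly_act_one)
  next
    case (eng g h)
    then show ?case using assms by (simp add: poly_act_mult)
  qed (rule S)
  then show ?thesis using assms by (simp add: poly_invariants_def)
qed

end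

section \<open>Sums of Jordan blocks\<close>

lemma prime_dvd_choose_prime_power:
  assumes "prime p" "0 < u" "u < p ^ s"
  shows "p dvd (p ^ s choose u)"
proof (rule ccontr)
  assume "\<not> p dvd (p ^ s choose u)"
  with \<open>prime p\<close> have "coprime (p ^ s) (p ^ s choose u)"
    by (simp add: prime_imp_coprime coprime_power_left_iff)
  \<comment> \<open>By absorption, coprimality would make \<open>p ^ s\<close> divide the smaller
    number \<open>u\<close>.\<close>
  moreover have "u * (p ^ s choose u) = p ^ s * (p ^ s - 1 choose (u - 1))"
    using binomial_absorption[of "u - 1" "p ^ s"] assms by simp
  ultimately have "p ^ s dvd u"
    using coprime_dvd_mult_left_iff by (metis dvd_triv_left)
  with assms show False by (auto dest: dvd_imp_le)
qed

lemma mpoly_subst_poly_cong: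
  fixes M :: "'a::field poly"
  assumes "\<And>m x. m \<in> Poly_Mapping.keys f \<Longrightarrow> x \<in> Poly_Mapping.keys m \<Longrightarrow> [\<phi> x = \<psi> x] (mod M)"
  shows "[mpoly_subst h \<phi> f = mpoly_subst h \<psi> f] (mod M)"
  unfolding mpoly_subst_def mono_subst_def using assms
  by (intro cong_sum cong_mult cong_prod cong_pow cong_refl) auto

text \<open>The power \<open>(1 + X) ^ d\<close> with \<open>d = p ^ b * d'\<close> is \<open>(1 + X ^ p ^ b) ^ d'\<close>, so \<open>(1 + X) ^ d - 1\<close>
  has order exactly \<open>p ^ b\<close> at \<open>0\<close> when \<open>p\<close> does not divide \<open>d'\<close>.\<close>

lemma prime_power_dvd_exponent:
  fixes P :: "'a::field poly"
  assumes p: "prime p" "CHAR('a) = p" and "d > 0" and P: "poly P 0 \<noteq> 0"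
    and dvd: "[:0, 1:] ^ Suc (p ^ a) dvd ([:1, 1:] ^ d - 1) * P"
  shows "p ^ Suc a dvd d"
proof (rule ccontr)
  assume contra: "\<not> p ^ Suc a dvd d"
  define X :: "'a poly" where "X = [:0, 1:]"
  have X0: "poly X 0 = 0" and X_dvd: "X dvd Q \<longleftrightarrow> poly Q 0 = 0" and "X \<noteq> 0" for Q
    using poly_eq_0_iff_dvd[of Q 0] by (simp_all add: X_def)
  have X1: "[:1, 1:] = 1 + X"
    unfolding X_def one_pCons by (simp only: add_pCons add_0_left add_0_right)
  have dvd': "X ^ Suc (p ^ a) dvd ((1 + X) ^ d - 1) * P"
    using dvd unfolding X1 by (simp only: X_def)
  have "\<not> is_unit p" using p(1) not_prime_unit by blast
  then obtain d' where d': "d = p ^ multiplicity p d * d'" "\<not> p dvd d'"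
    using \<open>d > 0\<close> multiplicity_decompose'[of d p] by auto
  define q where "q = p ^ multiplicity p d"
  define S where "S = (\<Sum>i<d'. (1 + X ^ q) ^ i)"
  have q: "q > 0" using p by (simp add: q_def prime_gt_0_nat)
  have "\<not> Suc a \<le> multiplicity p d"
    using contra multiplicity_dvd' by blast
  then have "q \<le> p ^ a"
    unfolding q_def using prime_ge_1_nat[OF p(1)] by (intro power_increasing) auto
  \<comment> \<open>As \<open>q \<le> p ^ a\<close>, cancelling \<open>X ^ q\<close> leaves at least
    one factor \<open>X\<close>, so the value at 0 decides.\<close>
  then obtain l where l: "Suc (p ^ a) = q + Suc l"
    using le_Suc_ex[of q "p ^ a"] by auto
  have "(1 + X) ^ q = 1 + X ^ q"
    using freshmans_dream'[of q "multiplicity p d" 1 X] p by (simp add: q_def)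
  then have "(1 + X) ^ d - 1 = (1 + X ^ q) ^ d' - 1"
    by (subst d'(1)) (simp add: power_mult q_def)
  also have "\<dots> = X ^ q * S"
    by (simp add: S_def power_diff_1_eq)
  finally have "X ^ q * X ^ Suc l dvd X ^ q * (S * P)"
    using dvd' by (simp only: l power_add mult.assoc)
  then have "X ^ Suc l dvd S * P"
    using \<open>X \<noteq> 0\<close> by (subst (asm) dvd_mult_cancel_left) simp
  then have "X dvd S * P"
    by (rule dvd_trans[rotated]) simp
  then have "poly (S * P) 0 = 0"
    by (simp only: X_dvd)
  \<comment> \<open>\<open>S\<close> has \<open>d'\<close> terms, each equal to 1 at 0, and
    \<open>p\<close> does not divide \<open>d'\<close>.\<close>
  moreover have "poly S 0 = of_nat d'"
    using q by (simp add: S_def poly_sum X0 zero_power)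
  ultimately show False
    using P d'(2) p by (simp add: of_nat_eq_0_iff_char_dvd)
qed

section \<open>Coordinates in the Jordan basis\<close>

locale jordan_module = g_module G scale B \<rho>
  for G :: "('g, 'm) monoid_scheme" (structure)
    and scale :: "'a::field \<Rightarrow> 'v::ab_group_add \<Rightarrow> 'v"
    and B :: "'v set"
    and \<rho> :: "'g \<Rightarrow> 'v \<Rightarrow> 'v" +
  fixes \<sigma> :: 'g and p r k :: nat and n :: "nat \<Rightarrow> nat" and e :: "nat \<Rightarrow> nat \<Rightarrow> 'v"
    and I :: "(nat \<times> nat) set"
  assumes char: "CHAR('a) = p" "p > 0"
    and r: "r \<ge> 1"
    and cyclic: "Coset.order G = p ^ r" "\<sigma> \<in> carrier G" "generate G {\<sigma>} = carrier G"
    and n: "\<And>j. j \<in> {1..k} \<Longrightarrow> 1 \<le> n j \<and> n j \<le> p ^ r"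
    and I: "I = {(i, j). 1 \<le> j \<and> j \<le> k \<and> 1 \<le> i \<and> i \<le> n j}"
    and B: "B = (\<lambda>(i, j). e i j) ` I" "inj_on (\<lambda>(i, j). e i j) I"
    and jordan: "\<And>i j. j \<in> {1..k} \<Longrightarrow> 1 \<le> i \<Longrightarrow> i < n j \<Longrightarrow> \<rho> (inv \<sigma>) (e i j) = e i j + e (i + 1) j"
      "\<And>j. j \<in> {1..k} \<Longrightarrow> \<rho> (inv \<sigma>) (e (n j) j) = e (n j) j"
begin

sublocale group G using group_hom by (simp add: group_hom_def)

lemma prime_p: "prime p"
  using prime_CHAR_semidom[where 'a = 'a] char by simp

lemma e_in_B [simp]: "(i, j) \<in> I \<Longrightarrow> e i j \<in> B"
  using B(1) by force

lemma e_eq_iff: "(i, j) \<in> I \<Longrightarrow> (i', j') \<in> I \<Longrightarrow> e i j = e i' j' \<longleftrightarrow> i = i' \<and> j = j'"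
  using inj_on_eq_iff[OF B(2), of "(i, j)" "(i', j')"] by simp

lemma top_in_I: "j \<in> {1..k} \<Longrightarrow> (n j, j) \<in> I"
  using n by (auto simp: I)

lemma finite_I: "finite I"
  using finite_imageD[of "\<lambda>(i, j). e i j" I] B finite_Basis by simp

lemma representation_e:
  "(i, j) \<in> I \<Longrightarrow> (i', j') \<in> I \<Longrightarrow> representation B (e i j) (e i' j') = of_bool (i = i' \<and> j = j')"
  using representation_basis[OF independent_Basis, of "e i j"] by (auto simp: e_eq_iff)

lemma representation_act_e:
  assumes "(i, j) \<in> I" "(i', j') \<in> I"
  shows "representation B (\<rho> (inv \<sigma>) (e i' j')) (e i j)
    = of_bool (i' = i \<and> j' = j) + of_bool (Suc i' = i \<and> j' = j)"
proof (cases "i' < n j'")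
  case True
  then have "(Suc i', j') \<in> I" using assms by (auto simp: I)
  moreover have "\<rho> (inv \<sigma>) (e i' j') = e i' j' + e (Suc i') j'"
    using jordan(1)[of j' i'] True assms by (auto simp: I)
  ultimately show ?thesis
    using assms by (simp add: representation_add[OF independent_Basis] span_Basis representation_e)
next
  case False
  then have "i' = n j'" using assms by (auto simp: I)
  then have "\<rho> (inv \<sigma>) (e i' j') = e i' j'"
    using jordan(2)[of j'] assms by (auto simp: I)
  then show ?thesis
    using assms \<open>i' = n j'\<close> by (auto simp: representation_e I)
qed

text \<open>Row \<open>(i, j)\<close> of the matrix of \<open>inv \<sigma>\<close> is nonzero only
  in the columns \<open>(i, j)\<close> and \<open>(i - 1, j)\<close>. General \<open>h\<close> and
  \<open>\<psi>\<close> cover coordinates of vectors, linear forms and points over F[X] at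
  once.\<close>

lemma sum_representation_act:
  fixes h :: "'a \<Rightarrow> 'b::comm_ring_1" and \<psi> :: "'v \<Rightarrow> 'b"
  assumes "coefficient_hom h" and ij: "(i, j) \<in> I"
  shows "(\<Sum>b\<in>B. h (representation B (\<rho> (inv \<sigma>) b) (e i j)) * \<psi> b)
    = \<psi> (e i j) + (if i = 1 then 0 else \<psi> (e (i - 1) j))"
proof -
  interpret h: coefficient_hom h by fact
  have h: "h (of_bool P) = of_bool P" for P by (cases P) simp_all
  have "(\<Sum>b\<in>B. h (representation B (\<rho> (inv \<sigma>) b) (e i j)) * \<psi> b)
      = (\<Sum>x\<in>I. h (representation B (\<rho> (inv \<sigma>) (e (fst x) (snd x))) (e i j)) * \<psi> (e (fst x) (snd x)))"
    unfolding B(1) using sum.reindex[OF B(2)] by (simp add: case_prod_unfold comp_def)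
  \<comment> \<open>For \<open>i = 1\<close> the index \<open>(0, j)\<close> lies outside
    \<open>I\<close>; the inner conditional gives 0 there.\<close>
  also have "\<dots> = (\<Sum>x\<in>I. (if x = (i, j) then \<psi> (e i j) else 0)
      + (if x = (i - 1, j) then if i = 1 then 0 else \<psi> (e (i - 1) j) else 0))"
  proof (rule sum.cong)
    fix x assume x: "x \<in> I"
    obtain i' j' where [simp]: "x = (i', j')" by (cases x)
    show "h (representation B (\<rho> (inv \<sigma>) (e (fst x) (snd x))) (e i j)) * \<psi> (e (fst x) (snd x))
      = (if x = (i, j) then \<psi> (e i j) else 0)
      + (if x = (i - 1, j) then if i = 1 then 0 else \<psi> (e (i - 1) j) else 0)"
      using ij x by (auto simp: representation_act_e h.hom_add h I)
  qed simp
  also have "\<dots> = \<psi> (e i j) + (if i = 1 then 0 else \<psi> (e (i - 1) j))"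
  proof -
    have "(i - 1, j) \<in> I" if "i \<noteq> 1" using ij that by (auto simp: I)
    then show ?thesis using ij finite_I by (simp add: sum.distrib sum.delta)
  qed
  finally show ?thesis .
qed

lemma coefficient_hom_id: "coefficient_hom (\<lambda>c::'a. c)"
  by unfold_locales simp_all

lemma representation_act_coord:
  assumes "(i, j) \<in> I"
  shows "representation B (\<rho> (inv \<sigma>) v) (e i j) = representation B v (e i j)
    + (if i = 1 then 0 else representation B v (e (i - 1) j))"
  using representation_act[of "inv \<sigma>" v "e i j"] cyclic(2)
    sum_representation_act[OF coefficient_hom_id assms, of "representation B v"] by simp

text \<open>At \<open>Suc i\<close> the coordinates of \<open>\<rho> (inv \<sigma>) v\<close> and
  \<open>v\<close> differ by the coordinate of \<open>v\<close> at \<open>i\<close>.\<close>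

lemma fixed_points_coord:
  assumes "v \<in> fixed_points" "(i, j) \<in> I" "i < n j"
  shows "representation B v (e i j) = 0"
proof -
  have "\<rho> (inv \<sigma>) v = v"
    using assms(1) cyclic(2) by (simp add: fixed_points_def)
  moreover have "(Suc i, j) \<in> I" "i \<noteq> 0" using assms by (auto simp: I)
  ultimately show ?thesis
    using representation_act_coord[of "Suc i" j v] by simp
qed

lemma fixed_points_nonzero_coord:
  assumes "v \<in> fixed_points" "v \<noteq> 0"
  obtains j where "j \<in> {1..k}" "representation B v (e (n j) j) \<noteq> 0"
proof -
  have "\<exists>j\<in>{1..k}. representation B v (e (n j) j) \<noteq> 0"
  proof (rule ccontr)
    assume no: "\<not> ?thesis"
    have "representation B v b = 0" if b_in: "b \<in> B" for b
    proof -
      obtain i j where b: "b = e i j" "(i, j) \<in> I" using b_in B(1) by auto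
      then have "j \<in> {1..k}" by (auto simp: I)
      then show ?thesis
        using fixed_points_coord[OF assms(1) b(2)] b no by (cases "i < n j") (auto simp: I)
    qed
    then have "v = 0"
      using sum_representation_eq[OF independent_Basis, of v B] by (simp add: span_Basis finite_Basis)
    with assms show False by simp
  qed
  then show thesis using that by blast
qed

section \<open>Upper bound: the norm of a coordinate function\<close>

text \<open>The orbit of the coordinate function of \<open>e (n j) j\<close> consists of the forms \<open>orbit_form j t\<close>.\<close>

definition orbit_form :: "nat \<Rightarrow> nat \<Rightarrow> ('v, 'a) mpoly" where
  "orbit_form j t = (\<Sum>u<n j. mpoly_const (of_nat (t choose u)) * mpoly_var (e (n j - u) j))"

text \<open>Pascal's rule: \<open>\<sigma>\<close> sends the indeterminate of index
  \<open>i > 1\<close> to itself plus that of index \<open>i - 1\<close>, so for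
  \<open>u > 0\<close> the coefficient at \<open>n j - u\<close> becomes
  \<open>(t choose u) + (t choose (u - 1))\<close>.\<close>

lemma poly_act_orbit_form:
  assumes "j \<in> {1..k}"
  shows "poly_act \<sigma> (orbit_form j t) = orbit_form j (Suc t)"
proof -
  let ?c = "\<lambda>t u. mpoly_const (of_nat (t choose u)) :: ('v, 'a) mpoly"
  let ?x = "\<lambda>i. mpoly_var (e i j) :: ('v, 'a) mpoly"
  obtain m where m: "n j = Suc m" using n[OF assms] by (cases "n j") auto
  have d: "dual_act \<sigma> (e i j) = ?x i + (if i = 1 then 0 else ?x (i - 1))" if "(i, j) \<in> I" for i
    using sum_representation_act[OF const_hom.coefficient_hom_axioms that, of mpoly_var]
    by (simp add: dual_act_def)
  have "poly_act \<sigma> (orbit_form j t) = (\<Sum>u<Suc m. ?c t u * dual_act \<sigma> (e (Suc m - u) j))"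
    by (simp add: poly_act_subst orbit_form_def const_hom.subst_sum const_hom.subst_mult m
        del: sum.lessThan_Suc)
  also have "\<dots> = (\<Sum>u<Suc m. ?c t u * ?x (Suc m - u)
      + ?c t u * (if u = m then 0 else ?x (m - u)))"
    using assms m by (intro sum.cong refl, subst d) (auto simp: I distrib_left)
  \<comment> \<open>The first sum is split at \<open>u = 0\<close> and shifted; the second loses its
    term \<open>u = m\<close>, since index 1 has no predecessor.\<close>
  also have "\<dots> = ?x (Suc m) + (\<Sum>u<m. ?c t (Suc u) * ?x (m - u)) + (\<Sum>u<m. ?c t u * ?x (m - u))"
    unfolding sum.distrib by (subst sum.lessThan_Suc_shift) simp
  also have "\<dots> = orbit_form j (Suc t)"
    unfolding orbit_form_def m
    by (subst sum.lessThan_Suc_shift) (simp add: mpoly_const_add distrib_right sum.distrib add_ac)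
  finally show ?thesis .
qed

lemma of_nat_choose_prime_power: "0 < u \<Longrightarrow> u < p ^ s \<Longrightarrow> of_nat (p ^ s choose u) = (0::'a)"
  using prime_dvd_choose_prime_power[OF prime_p] char by (simp add: of_nat_eq_0_iff_char_dvd)

text \<open>Only \<open>u < n j \<le> p ^ s\<close> occur, and there \<open>p ^ s choose u\<close>
  vanishes in the field except at \<open>u = 0\<close>.\<close>

lemma orbit_form_period:
  assumes "j \<in> {1..k}" "n j \<le> p ^ s"
  shows "orbit_form j (p ^ s) = orbit_form j 0"
  unfolding orbit_form_def
proof (rule sum.cong)
  fix u assume "u \<in> {..<n j}"
  then have "of_nat (p ^ s choose u) = (of_nat (0 choose u) :: 'a)"
    using of_nat_choose_prime_power[of u s] assms by (cases u) auto
  then show "mpoly_const (of_nat (p ^ s choose u)) * mpoly_var (e (n j - u) j)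
    = mpoly_const (of_nat (0 choose u) :: 'a) * mpoly_var (e (n j - u) j)" by simp
qed simp

text \<open>Applying \<open>\<sigma>\<close> raises each index \<open>t\<close> by one, and the new
  last factor, of index \<open>p ^ s\<close>, is the old first one.\<close>

lemma invariant_of_norm:
  assumes j: "j \<in> {1..k}" "n j \<le> p ^ s"
  shows "(\<Prod>t<p ^ s. orbit_form j t) \<in> poly_invariants_deg (p ^ s)"
proof -
  let ?N = "\<Prod>t<p ^ s. orbit_form j t"
  have "?N \<in> poly_ring"
    unfolding orbit_form_def using j(1)
    by (intro poly_ring_prod poly_ring_sum poly_ring_const_mult_var e_in_B) (auto simp: I)
  moreover have "poly_act \<sigma> ?N = ?N"
  proof -
    obtain q where q: "p ^ s = Suc q" using char by (cases "p ^ s") auto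
    have "poly_act \<sigma> ?N = (\<Prod>t<p ^ s. orbit_form j (Suc t))"
      using poly_act_orbit_form[OF j(1)] by (simp add: poly_act_subst const_hom.subst_prod)
    also have "\<dots> = (\<Prod>t<q. orbit_form j (Suc t)) * orbit_form j 0"
      using orbit_form_period[OF j] by (simp add: q)
    also have "\<dots> = ?N"
      unfolding q by (subst prod.lessThan_Suc_shift) (simp add: mult.commute)
    finally show ?thesis .
  qed
  ultimately have "?N \<in> poly_invariants"
    using cyclic by (intro poly_invariantsI[of "{\<sigma>}"]) auto
  moreover have "mpoly_homogeneous 1 (orbit_form j t)" for t
    unfolding orbit_form_def by (intro mpoly_homogeneous_sum mpoly_homogeneous_const_mult_var)
  then have "mpoly_homogeneous (\<Sum>t<p ^ s. 1) ?N"
    by (intro mpoly_homogeneous_prod)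
  ultimately show ?thesis
    by (simp add: poly_invariants_deg_def)
qed

text \<open>At a fixed point only the indeterminate of \<open>e (n j) j\<close> in the block
  survives, and every form contains it with coefficient \<open>t choose 0 = 1\<close>.\<close>

lemma poly_eval_norm:
  assumes "j \<in> {1..k}" "v \<in> fixed_points"
  shows "poly_eval (\<Prod>t<q. orbit_form j t) v = representation B v (e (n j) j) ^ q"
proof -
  obtain m where m: "n j = Suc m" using n[OF assms(1)] by (cases "n j") auto
  have "representation B v (e (m - u) j) = 0" if "u < m" for u
    using assms that m by (intro fixed_points_coord) (auto simp: I)
  then have "poly_eval (orbit_form j t) v = representation B v (e (n j) j)" for t
    unfolding orbit_form_def poly_eval_sum poly_eval_mult m
    using poly_eval_const[of 1 v] by (subst sum.lessThan_Suc_shift) simp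
  then show ?thesis
    by (simp add: poly_eval_prod)
qed

section \<open>Lower bound: evaluation at a point over F[X]\<close>

text \<open>Substituting \<open>c X ^ (n j - i)\<close> for the coordinate function of \<open>e i j\<close>, where \<open>c\<close> is the coordinate
  of \<open>v\<close> at \<open>e (n j) j\<close>, means evaluating at a point that specialises to \<open>v\<close> at \<open>X = 0\<close> and on which
  the generator acts modulo \<open>X ^ Suc (p ^ a)\<close> as multiplication by \<open>1 + X\<close>.\<close>

lemma invariant_degree_dvd:
  assumes v: "v \<in> fixed_points" and f: "f \<in> poly_invariants_deg d" "poly_eval f v \<noteq> 0" and "d > 0"
    and a: "\<And>j. j \<in> {1..k} \<Longrightarrow> representation B v (e (n j) j) \<noteq> 0 \<Longrightarrow> p ^ a < n j"
  shows "p ^ Suc a dvd d"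
proof -
  let ?h = "\<lambda>c::'a. [:c:]"
  \<comment> \<open>\<open>\<psi>\<close> has to be a function of basis vectors, so
    \<open>ix\<close> recovers the index pair.\<close>
  define ix where "ix = the_inv_into I (\<lambda>(i, j). e i j)"
  have ix: "ix (e i j) = (i, j)" if "(i, j) \<in> I" for i j
    unfolding ix_def using the_inv_into_f_f[OF B(2) that] by simp
  define \<psi> where "\<psi> b = (case ix b of (i, j) \<Rightarrow> Polynomial.smult (representation B v (e (n j) j)) ([:0, 1:] ^ (n j - i)))" for b
  have \<psi>: "\<psi> (e i j) = Polynomial.smult (representation B v (e (n j) j)) ([:0, 1:] ^ (n j - i))" if "(i, j) \<in> I" for i j
    using ix[OF that] by (simp add: \<psi>_def)
  define P where "P = mpoly_subst ?h \<psi> f"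
  have ring: "Poly_Mapping.keys m \<subseteq> B" if "m \<in> Poly_Mapping.keys f" for m
    using f(1) that by (auto simp: poly_invariants_deg_def poly_invariants_def poly_ring_def)
  have B_cases: "\<exists>i j. b = e i j \<and> (i, j) \<in> I"
    if "m \<in> Poly_Mapping.keys f" "b \<in> Poly_Mapping.keys m" for m b
    using subsetD[OF ring[OF that(1)] that(2)] B(1) by auto
  have hom: "mpoly_homogeneous d f" and inv: "poly_act \<sigma> f = f"
    using f(1) cyclic(2) by (auto simp: poly_invariants_deg_def poly_invariants_def)

  \<comment> \<open>At \<open>X = 0\<close> only the coordinates with \<open>i = n j\<close> remain;
    the others are zero for the fixed point \<open>v\<close> as well.\<close>
  have "poly P 0 = mpoly_subst (\<lambda>c. c) (\<lambda>b. poly (\<psi> b) 0) f"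
    by (simp add: P_def mpoly_subst_def mono_subst_def poly_sum poly_prod)
  also have "\<dots> = poly_eval f v"
    unfolding poly_eval_def
  proof (rule mpoly_subst_cong)
    fix m b assume "m \<in> Poly_Mapping.keys f" "b \<in> Poly_Mapping.keys m"
    then obtain i j where b: "b = e i j" "(i, j) \<in> I" using B_cases by blast
    then show "poly (\<psi> b) 0 = representation B v b"
      using fixed_points_coord[OF v, of i j] by (cases "i < n j") (auto simp: \<psi> I)
  qed
  finally have P0: "poly P 0 \<noteq> 0" using f by simp

  \<comment> \<open>The moved point is the old one times \<open>1 + X\<close>: exactly for
    \<open>i > 1\<close>, and modulo the power of \<open>X\<close> for \<open>i = 1\<close>.\<close>
  have "[mpoly_subst ?h (\<lambda>b. mpoly_subst ?h \<psi> (dual_act \<sigma> b)) f = mpoly_subst ?h (\<lambda>b. [:1, 1:] * \<psi> b) f]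
    (mod [:0, 1:] ^ Suc (p ^ a))"
  proof (rule mpoly_subst_poly_cong)
    fix m b assume "m \<in> Poly_Mapping.keys f" "b \<in> Poly_Mapping.keys m"
    then obtain i j where b: "b = e i j" and ij: "(i, j) \<in> I" using B_cases by blast
    have eq: "mpoly_subst ?h \<psi> (dual_act \<sigma> b) = \<psi> b + (if i = 1 then 0 else \<psi> (e (i - 1) j))"
      using sum_representation_act[OF poly_const_hom.coefficient_hom_axioms ij, of \<psi>]
      by (simp add: dual_act_def b poly_const_hom.subst_sum poly_const_hom.subst_mult)
    show "[mpoly_subst ?h \<psi> (dual_act \<sigma> b) = [:1, 1:] * \<psi> b] (mod [:0, 1:] ^ Suc (p ^ a))"
    proof (cases "i = 1")
      case False
      then have "(i - 1, j) \<in> I" "n j - (i - 1) = Suc (n j - i)" using ij by (auto simp: I)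
      then have "\<psi> (e (i - 1) j) = [:0, 1:] * \<psi> b"
        using ij by (simp add: \<psi> b)
      then have "mpoly_subst ?h \<psi> (dual_act \<sigma> b) = [:1, 1:] * \<psi> b"
        unfolding eq using False by simp
      then show ?thesis by simp
    next
      case True
      \<comment> \<open>For \<open>i = 1\<close> the summand \<open>X * \<psi> b\<close> is missing.
        It is a multiple of \<open>X ^ n j\<close> whose coefficient is zero unless
        \<open>p ^ a < n j\<close>.\<close>
      have "[:0, 1:] ^ Suc (p ^ a) dvd [:0, 1:] * \<psi> b"
      proof (cases "representation B v (e (n j) j) = 0")
        case True
        then show ?thesis using ij by (simp add: \<psi> b)
      next
        case False
        then have "Suc (p ^ a) \<le> n j" using a[of j] ij by (auto simp: I)
        moreover have "[:0, 1:] * \<psi> b = Polynomial.smult (representation B v (e (n j) j)) ([:0, 1:] ^ n j)"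
          using ij \<open>i = 1\<close> by (cases "n j") (auto simp: \<psi> b I)
        ultimately show ?thesis
          by (metis dvd_smult le_imp_power_dvd)
      qed
      moreover have "mpoly_subst ?h \<psi> (dual_act \<sigma> b) - [:1, 1:] * \<psi> b = - ([:0, 1:] * \<psi> b)"
        unfolding eq using True by simp
      ultimately show ?thesis
        unfolding cong_iff_dvd_diff by (simp only: dvd_minus_iff)
    qed
  qed
  \<comment> \<open>Invariance turns the left side into \<open>P\<close>; homogeneity turns the
    right side into \<open>(1 + X) ^ d * P\<close>.\<close>
  moreover have "mpoly_subst ?h (\<lambda>b. mpoly_subst ?h \<psi> (dual_act \<sigma> b)) f = P"
    using inv by (simp add: P_def poly_const_hom.subst_subst[symmetric] poly_act_subst)
  moreover have "mpoly_subst ?h (\<lambda>b. [:1, 1:] * \<psi> b) f = [:1, 1:] ^ d * P"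
    by (simp only: mpoly_subst_scale[OF hom] P_def)
  ultimately have "[P = [:1, 1:] ^ d * P] (mod [:0, 1:] ^ Suc (p ^ a))"
    by (simp only:)
  then have "[[:1, 1:] ^ d * P = P] (mod [:0, 1:] ^ Suc (p ^ a))"
    by (rule cong_sym)
  then have "[:0, 1:] ^ Suc (p ^ a) dvd ([:1, 1:] ^ d - 1) * P"
    by (simp add: cong_iff_dvd_diff left_diff_distrib)
  then show ?thesis
    using prime_power_dvd_exponent[OF prime_p char(1) \<open>d > 0\<close> P0] by simp
qed

section \<open>The value of \<open>epsilon\<close>\<close>

lemma epsilon_eq:
  assumes v: "v \<in> fixed_points"
    and j: "j \<in> {1..k}" "representation B v (e (n j) j) \<noteq> 0" "n j \<le> p ^ s"
    and s: "\<And>j a. j \<in> {1..k} \<Longrightarrow> representation B v (e (n j) j) \<noteq> 0 \<Longrightarrow> s = Suc a \<Longrightarrow> p ^ a < n j"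
  shows "epsilon v = enat (p ^ s)"
proof (rule antisym)
  show "epsilon v \<le> enat (p ^ s)"
  proof -
    have "poly_eval (\<Prod>t<p ^ s. orbit_form j t) v \<noteq> 0"
      using j(2) by (simp add: poly_eval_norm[OF j(1) v])
    moreover have "p ^ s > 0" using char(2) by simp
    ultimately show ?thesis
      unfolding epsilon_def using invariant_of_norm[OF j(1,3)] by (intro Inf_lower CollectI) blast
  qed
  \<comment> \<open>For \<open>s = 0\<close> this is just \<open>d > 0\<close>; writing
    \<open>s = Suc a\<close> in the hypothesis avoids the exponent -1.\<close>
  have "p ^ s \<le> d" if "d > 0" "f \<in> poly_invariants_deg d" "poly_eval f v \<noteq> 0" for d f
  proof (cases s)
    case (Suc a)
    then have "p ^ Suc a dvd d"
      using s that by (intro invariant_degree_dvd[OF v that(2,3,1)]) auto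
    then show ?thesis using that Suc by (auto dest: dvd_imp_le)
  qed (use that in auto)
  then show "enat (p ^ s) \<le> epsilon v"
    unfolding epsilon_def by (intro Inf_greatest) auto
qed

text \<open>Take a shortest block \<open>j\<close> with nonzero coordinate and the least
  \<open>s\<close> with \<open>n j \<le> p ^ s\<close>. Leastness of \<open>s\<close> gives
  \<open>p ^ a < n j\<close> for \<open>s = Suc a\<close>, hence the same for all relevant blocks,
  and \<open>n j \<le> p ^ r\<close> gives \<open>s \<le> r\<close>.\<close>

lemma epsilon_exponent:
  assumes "v \<in> fixed_points" "v \<noteq> 0"
  obtains s j where "epsilon v = enat (p ^ s)" "s \<le> r"
    "j \<in> {1..k}" "representation B v (e (n j) j) \<noteq> 0" "n j \<le> p ^ s"
    "\<And>j a. j \<in> {1..k} \<Longrightarrow> representation B v (e (n j) j) \<noteq> 0 \<Longrightarrow> s = Suc a \<Longrightarrow> p ^ a < n j"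
proof -
  let ?P = "\<lambda>j. j \<in> {1..k} \<and> representation B v (e (n j) j) \<noteq> 0"
  obtain j0 where "?P j0"
    using fixed_points_nonzero_coord[OF assms] by blast
  then obtain j where j: "?P j" and min: "\<And>j'. ?P j' \<Longrightarrow> n j \<le> n j'"
    using ex_has_least_nat[of ?P j0 n] by blast
  define s where "s = (LEAST s. n j \<le> p ^ s)"
  have r: "n j \<le> p ^ r" using n j by simp
  have s: "n j \<le> p ^ s" "s \<le> r"
    unfolding s_def using r by (auto intro: LeastI Least_le)
  have below: "p ^ a < n j'" if "?P j'" "s = Suc a" for j' a
    using not_less_Least[of a "\<lambda>s. n j \<le> p ^ s"] min[OF that(1)] that(2) by (simp add: s_def)
  show thesis
    using that[of s j] epsilon_eq[OF assms(1), of j s] j s below by blast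
qed

section \<open>Faithful modules and \<open>delta\<close>\<close>

text \<open>Binomial expansion of a power of identity plus shift; \<open>x\<close> continues the
  block by zero, so that the sum can run over all \<open>u \<le> t\<close>.\<close>

lemma act_power_e:
  assumes j: "j \<in> {1..k}" and "i \<ge> 1"
  defines "x \<equiv> \<lambda>i. if i \<le> n j then e i j else 0"
  shows "(\<rho> (inv \<sigma>) ^^ t) (x i) = (\<Sum>u\<le>t. scale (of_nat (t choose u)) (x (i + u)))"
  using \<open>i \<ge> 1\<close>
proof (induction t arbitrary: i)
  case (Suc t)
  interpret L: Vector_Spaces.linear scale scale "\<rho> (inv \<sigma>)"
    using linear_act cyclic(2) by simp
  have add: "(\<rho> (inv \<sigma>) ^^ t) (v + w) = (\<rho> (inv \<sigma>) ^^ t) v + (\<rho> (inv \<sigma>) ^^ t) w" for v w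
    by (induction t) (simp_all add: L.add)
  have "\<rho> (inv \<sigma>) (x i) = x i + x (Suc i)"
    using jordan(1)[OF j, of i] jordan(2)[OF j] Suc.prems
    by (cases i "n j" rule: linorder_cases) (auto simp: x_def L.zero)
  then have "(\<rho> (inv \<sigma>) ^^ Suc t) (x i) = (\<rho> (inv \<sigma>) ^^ t) (x i) + (\<rho> (inv \<sigma>) ^^ t) (x (Suc i))"
    by (simp add: funpow_Suc_right add del: funpow.simps)
  \<comment> \<open>The added term \<open>u = Suc t\<close> is zero; it aligns the two sums for
    Pascal's rule.\<close>
  also have "(\<rho> (inv \<sigma>) ^^ t) (x i) = (\<Sum>u\<le>Suc t. scale (of_nat (t choose u)) (x (i + u)))"
    using Suc by (simp add: binomial_eq_0)
  also have "\<dots> = x i + (\<Sum>u\<le>t. scale (of_nat (t choose Suc u)) (x (i + Suc u)))"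
    by (subst sum.atMost_Suc_shift) simp
  also have "\<dots> + (\<rho> (inv \<sigma>) ^^ t) (x (Suc i))
      = (\<Sum>u\<le>Suc t. scale (of_nat (Suc t choose u)) (x (i + u)))"
    by (subst sum.atMost_Suc_shift)
      (simp add: Suc scale_left_distrib sum.distrib add_ac)
  finally show ?case .
qed simp

text \<open>In the binomial expansion the terms with \<open>0 < u < p ^ s\<close> vanish by the
  characteristic, and \<open>u = p ^ s\<close> leads past the end of the block.\<close>

lemma act_power_period:
  assumes "\<And>j. j \<in> {1..k} \<Longrightarrow> n j \<le> p ^ s" "b \<in> B"
  shows "(\<rho> (inv \<sigma>) ^^ (p ^ s)) b = b"
proof -
  obtain i j where b: "b = e i j" "(i, j) \<in> I" using assms(2) B(1) by auto
  then have ij: "j \<in> {1..k}" "i \<ge> 1" "i \<le> n j" by (auto simp: I)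
  let ?x = "\<lambda>i. if i \<le> n j then e i j else 0"
  have "(\<rho> (inv \<sigma>) ^^ (p ^ s)) (?x i) = (\<Sum>u\<le>p ^ s. scale (of_nat (p ^ s choose u)) (?x (i + u)))"
    using act_power_e[OF ij(1,2)] .
  also have "\<dots> = (\<Sum>u\<in>{0}. scale (of_nat (p ^ s choose u)) (?x (i + u)))"
  proof (rule sum.mono_neutral_right)
    show "\<forall>u\<in>{..p ^ s} - {0}. scale (of_nat (p ^ s choose u)) (?x (i + u)) = 0"
    proof
      fix u assume u: "u \<in> {..p ^ s} - {0}"
      show "scale (of_nat (p ^ s choose u)) (?x (i + u)) = 0"
      proof (cases "u = p ^ s")
        case True
        then have "\<not> i + u \<le> n j" using ij assms(1)[OF ij(1)] by linarith
        then show ?thesis by simp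
      next
        case False
        then have "of_nat (p ^ s choose u) = (0::'a)"
          using u by (intro of_nat_choose_prime_power) auto
        then show ?thesis by simp
      qed
    qed
  qed auto
  finally show ?thesis using ij by (simp add: b)
qed

lemma act_power: "\<rho> (inv \<sigma> [^] t) = \<rho> (inv \<sigma>) ^^ t"
proof (induction t)
  case 0
  show ?case by (simp add: fun_eq_iff act_one)
next
  case (Suc t)
  have "\<rho> (inv \<sigma> [^] Suc t) v = \<rho> (inv \<sigma> [^] t) (\<rho> (inv \<sigma>) v)" for v
    using composition_rule[of v "inv \<sigma> [^] t" "inv \<sigma>"] cyclic(2) by simp
  then show ?case by (simp add: Suc fun_eq_iff funpow_swap1)
qed

text \<open>Otherwise \<open>inv \<sigma> [^] (p ^ (r - 1))\<close> fixes the basis and hence acts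
  trivially, although \<open>inv \<sigma>\<close> has order \<open>p ^ r\<close>.\<close>

lemma faithful_large_block:
  assumes "faithful_action G (UNIV :: 'v set) \<rho>"
  obtains j where "j \<in> {1..k}" "p ^ (r - 1) < n j"
proof (rule ccontr)
  assume "\<not> thesis"
  then have small: "\<And>j. j \<in> {1..k} \<Longrightarrow> n j \<le> p ^ (r - 1)"
    using that not_less by blast
  let ?g = "inv \<sigma> [^] (p ^ (r - 1))"
  have g: "?g \<in> carrier G" using cyclic(2) by simp
  have "\<rho> ?g b = b" if "b \<in> B" for b
    using act_power_period[OF small that] by (simp add: act_power)
  moreover have "vector_space_pair scale scale" ..
  ultimately have "\<rho> ?g v = \<rho> \<one> v" for v
    using vector_space_pair.linear_eq_on[of scale scale "\<rho> ?g" "\<rho> \<one>" v B]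
      linear_act[OF g] linear_act[OF one_closed] act_one by (simp add: span_Basis)
  then have "?g = \<one>"
    using assms g unfolding faithful_action_def faithful_action_axioms_def by (auto dest: inj_onD)
  then have "ord (inv \<sigma>) dvd p ^ (r - 1)"
    using cyclic(2) by (simp add: pow_eq_id)
  moreover have "ord (inv \<sigma>) = p ^ r"
    using cyclic generate_pow_card[of \<sigma>] by (simp add: ord_inv Coset.order_def)
  ultimately have "r \<le> r - 1"
    using prime_p by (metis power_dvd_imp_le prime_gt_1_nat)
  then show False using r by simp
qed

lemma top_fixed:
  assumes "j \<in> {1..k}"
  shows "e (n j) j \<in> fixed_points"
proof -
  have comp: "\<rho> (g \<otimes> h) v = \<rho> g (\<rho> h v)" if "g \<in> carrier G" "h \<in> carrier G" for g h v
    using composition_rule[of v g h] that by simp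
  let ?v = "e (n j) j"
  have inv: "\<rho> (inv \<sigma>) ?v = ?v" using jordan(2)[OF assms] .
  then have \<sigma>: "\<rho> \<sigma> ?v = ?v"
    using comp[of \<sigma> "inv \<sigma>" ?v] cyclic(2) by (simp add: act_one)
  have "\<rho> g ?v = ?v" if "g \<in> generate G {\<sigma>}" for g
    using that
  proof induction
    case (eng g h)
    then show ?case using cyclic(3) by (simp add: comp)
  qed (use inv \<sigma> act_one in auto)
  then show ?thesis
    using cyclic(3) by (simp add: fixed_points_def)
qed

lemma delta_faithful:
  assumes "faithful_action G (UNIV :: 'v set) \<rho>"
  shows "delta = enat (p ^ r)"
proof -
  obtain j where j: "j \<in> {1..k}" "p ^ (r - 1) < n j"
    using faithful_large_block[OF assms] .
  let ?v = "e (n j) j"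
  have rep: "representation B ?v (e (n j') j') = of_bool (j = j')" if "j' \<in> {1..k}" for j'
    using representation_e[OF top_in_I[OF j(1)] top_in_I[OF that]] by auto
  have "?v \<noteq> 0"
    using dependent_zero[of B] independent_Basis e_in_B[OF top_in_I[OF j(1)]] by metis
  \<comment> \<open>The only nonzero end coordinate of \<open>?v\<close> belongs to block
    \<open>j\<close>, and \<open>p ^ (r - 1) < n j \<le> p ^ r\<close>.\<close>
  moreover have eps: "epsilon ?v = enat (p ^ r)"
    using top_fixed[OF j(1)] j(1) n j
    by (intro epsilon_eq[of _ j]) (auto simp: rep split: if_splits)
  moreover have "epsilon v \<le> enat (p ^ r)" if v: "v \<in> fixed_points - {0}" for v
  proof -
    obtain s where "epsilon v = enat (p ^ s)" "s \<le> r"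
      using epsilon_exponent[of v] v by (metis DiffE singletonI)
    then show ?thesis
      using char by (simp add: power_increasing)
  qed
  ultimately have "(SUP v\<in>fixed_points - {0}. epsilon v) = enat (p ^ r)"
    using top_fixed[OF j(1)] by (intro antisym SUP_least SUP_upper2[of ?v]) auto
  moreover have "fixed_points \<noteq> {0}"
    using top_fixed[OF j(1)] \<open>?v \<noteq> 0\<close> by blast
  ultimately show ?thesis
    by (simp add: delta_def)
qed

end

section \<open>The exponent as a greatest integer\<close>

theorem theorem4:
  fixes G :: "('g, 'm) monoid_scheme" (structure)
    and scale :: "'a::alg_closed_field \<Rightarrow> 'v::ab_group_add \<Rightarrow> 'v"
    and \<rho> :: "'g \<Rightarrow> 'v \<Rightarrow> 'v"
    and \<sigma> :: 'g
    and p r k :: nat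
    and n :: "nat \<Rightarrow> nat"
    and e :: "nat \<Rightarrow> nat \<Rightarrow> 'v"
    and I :: "(nat \<times> nat) set"
    and B :: "'v set"
  assumes char: "CHAR('a) = p" "p > 0"
    and r: "r \<ge> 1"
    and cyclic: "group G" "Coset.order G = p ^ r" "\<sigma> \<in> carrier G" "generate G {\<sigma>} = carrier G"
    and n: "\<And>j. j \<in> {1..k} \<Longrightarrow> 1 \<le> n j \<and> n j \<le> p ^ r"
    and I: "I = {(i, j). 1 \<le> j \<and> j \<le> k \<and> 1 \<le> i \<and> i \<le> n j}"
    and B: "B = (\<lambda>(i, j). e i j) ` I" "inj_on (\<lambda>(i, j). e i j) I"
    and module: "g_module G scale B \<rho>"
    and jordan: "\<And>i j. j \<in> {1..k} \<Longrightarrow> 1 \<le> i \<Longrightarrow> i < n j \<Longrightarrow> \<rho> (inv \<sigma>) (e i j) = e i j + e (i + 1) j"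
      "\<And>j. j \<in> {1..k} \<Longrightarrow> \<rho> (inv \<sigma>) (e (n j) j) = e (n j) j"
  shows "(\<forall>(c :: nat \<Rightarrow> 'a) (v :: 'v) (J :: nat set) (s :: int).
            v = (\<Sum>j=1..k. scale (c j) (e (n j) j)) \<longrightarrow>
            v \<in> g_module.fixed_points G \<rho> - {0} \<longrightarrow>
            J = {j \<in> {1..k}. c j \<noteq> 0} \<longrightarrow>
            s = (GREATEST t. \<forall>j\<in>J. real p powi (t - 1) < real (n j)) \<longrightarrow>
            0 \<le> s \<and> g_module.epsilon G scale B \<rho> v = enat (p ^ nat s))
       \<and> (faithful_action G (UNIV :: 'v set) \<rho> \<longrightarrow> g_module.delta G scale B \<rho> = enat (p ^ r))"
proof -
  interpret jordan_module G scale B \<rho> \<sigma> p r k n e I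
    using assms by (auto intro!: jordan_module.intro jordan_module_axioms.intro)
  have "0 \<le> s \<and> epsilon v = enat (p ^ nat s)"
    if v: "v = (\<Sum>j=1..k. scale (c j) (e (n j) j))" "v \<in> fixed_points - {0}"
      and J: "J = {j \<in> {1..k}. c j \<noteq> 0}"
      and s: "s = (GREATEST t. \<forall>j\<in>J. real p powi (t - 1) < real (n j))" for c v J and s :: int
  proof -
    have rep: "representation B v (e (n j) j) = c j" if j: "j \<in> {1..k}" for j
    proof -
      have "representation B v (e (n j) j) = (\<Sum>l=1..k. c l * of_bool (l = j))"
      proof -
        have "representation B (e (n l) l) (e (n j) j) = of_bool (l = j)" if "l \<in> {1..k}" for l
          using representation_e[OF top_in_I[OF that] top_in_I[OF j]] by auto
        then show ?thesis
          unfolding v(1) by (simp add: representation_sum[OF independent_Basis]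
              representation_scale[OF independent_Basis] span_Basis del: sum_mult_of_bool_eq)
      qed
      also have "\<dots> = c j" using j by (simp add: of_bool_def if_distrib sum.delta cong: if_cong)
      finally show ?thesis .
    qed
    obtain q j where q: "epsilon v = enat (p ^ q)" and j: "j \<in> {1..k}" "c j \<noteq> 0" "n j \<le> p ^ q"
      and below: "\<And>j a. j \<in> {1..k} \<Longrightarrow> c j \<noteq> 0 \<Longrightarrow> q = Suc a \<Longrightarrow> p ^ a < n j"
      using epsilon_exponent[of v] v(2) rep by (metis DiffE singletonI)
    have p1: "1 < real p" using prime_gt_1_nat[OF prime_p] by simp
    \<comment> \<open>\<open>GREATEST\<close> is meaningful only once a maximum is known, so
      \<open>q\<close> is shown to satisfy the condition and to bound every such
      \<open>t\<close>.\<close>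
    have "s = int q"
      unfolding s
    proof (rule Greatest_equality)
      show "\<forall>j\<in>J. real p powi (int q - 1) < real (n j)"
      proof
        fix j assume "j \<in> J"
        then have j: "j \<in> {1..k}" "c j \<noteq> 0" by (auto simp: J)
        show "real p powi (int q - 1) < real (n j)"
        proof (cases q)
          case 0
          \<comment> \<open>The exponent is negative here, and \<open>1 / p\<close> is below every
            block length.\<close>
          have "real p powi (-1) < 1" using p1 by (simp add: power_int_minus field_simps)
          also have "1 \<le> real (n j)" using n[OF j(1)] by simp
          finally show ?thesis by (simp add: 0)
        next
          case (Suc a)
          then show ?thesis using below[OF j Suc] by (simp flip: of_nat_power)
        qed
      qed
    next
      \<comment> \<open>Any \<open>t > q\<close> fails at the block \<open>j\<close> with
        \<open>n j \<le> p ^ q\<close>.\<close>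
      fix t assume t: "\<forall>j\<in>J. real p powi (t - 1) < real (n j)"
      show "t \<le> int q"
      proof (rule ccontr)
        assume "\<not> t \<le> int q"
        then have "real p powi int q \<le> real p powi (t - 1)"
          using p1 by (intro power_int_increasing) auto
        moreover have "real (n j) \<le> real p powi int q"
          using j(3) by (simp flip: of_nat_power)
        moreover have "real p powi (t - 1) < real (n j)"
          using t j by (simp add: J)
        ultimately show False by linarith
      qed
    qed
    then show ?thesis using q by simp
  qed
  then show ?thesis
    using delta_faithful by blast
qed

end
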